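(* For all integers $d \geq 1$, $p \geq 2$, and $n \geq 1$, $C_{d,p}(n)$ counts the number of interchange maximal trees in $\mathcal{T}_{d,p,n}$.
   Context: Write $[k]=\{1,\dots,k\}$. Fix integers $d\ge 1$ and $p\ge 2$. Decompositions. For an open rectangle $R=(a_1,b_1)\times\cdots\times(a_d,b_d)\subseteq(0,1)^d$ and $i\in[d]$, put $c_i(j)=a_i+\frac{j}{p}(b_i-a_i)$ for $0\le j\le p$. The $p$-splitting of $R$ in the coordinate $i$ is the set of $p$ open rectangles $H_i(R)=\{(a_1,b_1)\times\cdots\times(c_i(j-1),c_i(j))\times\cdots\times(a_d,b_d) : 1\le j\le p\}$, where only the $i$-th factor is changed. Fix an integer $m\ge 0$, start with $S_0=\{(0,1)^d\}$, and for $k=1,\dots,m$ choose any $R\in S_{k-1}$ and any $i\in[d]$ and set $S_k=(S_{k-1}\setminus\{R\})\cup H_i(R)$. Any resulting set $S_m$ is a $(d,p,n)$-decomposition, where $n=1+m(p-1)=|S_m|$. $\mathcal{D}_{d,p,n}$ is the set of all $(d,p,n)$-decompositions, and $C_{d,p}(n)=|\mathcal{D}_{d,p,n}|$. Trees. $\mathcal{T}_{d,p,n}$ is the set of full $p$-ary plane rooted trees (every internal node has exactly $p$ children, ordered left to right) with $n$ unlabelled leaves, in which each of the $\frac{n-1}{p-1}$ internal nodes is assigned a label from $[d]$. (For $n=1$ it contains only the tree with a single node, which is a leaf.) Scaling. For open rectangles $R=\prod_i(a_i,b_i)$ and $R'=\prod_i(a'_i,b'_i)$ in $(0,1)^d$,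 let $L_{R\to R'}:\mathbb{R}^d\to\mathbb{R}^d$ be the affine map with $[L_{R\to R'}(x)]_i=a'_i+\frac{b'_i-a'_i}{b_i-a_i}(x_i-a_i)$, and for $R''\subseteq R$ let $\mathrm{scale}_{R\to R'}(R'')=\{L_{R\to R'}(x):x\in R''\}$. For $i\in[d]$, $j\in[p]$ let $B_{i,j}=\{x\in(0,1)^d:\frac{j-1}{p}<x_i<\frac{j}{p}\}$. The map $f:\mathcal{T}_{d,p,n}\to\mathcal{D}_{d,p,n}$ is defined recursively: the single-node tree is mapped to $\{(0,1)^d\}$; if $T$ has root labelled $i$ and the subtrees at the children of the root are, from left to right, $T_1,\dots,T_p$, then $f(T)=\bigcup_{j=1}^p\{\mathrm{scale}_{(0,1)^d\to B_{i,j}}(R):R\in f(T_j)\}$. A tree $T\in\mathcal{T}_{d,p,n}$ is interchange maximal if it has no subtree $\tilde T$ (a node of $T$ together with all its descendants) such that: (T1) $\tilde T$ has root labelled $i$ (so the root is an internal node); and (T2) there exists a tree $\tilde T'$ (in $\mathcal{T}_{d,p,n'}$ for some $n'$) with root labelled $j$, where $j>i$, such that $f(\tilde T')=f(\tilde T)$. *)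

theory Defs
  imports Complex_Main "HOL-Library.FuncSet"
begin

(* A point of R^d is an extensional function on {1..d} (value undefined elsewhere), so that
   equality of sets of points is the usual equality of subsets of R^d. *)

definition rect :: "nat \<Rightarrow> (nat \<Rightarrow> real) \<Rightarrow> (nat \<Rightarrow> real) \<Rightarrow> (nat \<Rightarrow> real) set" where
  "rect d a b = (\<Pi>\<^sub>E k\<in>{1..d}. {a k<..<b k})"

definition unit_cube :: "nat \<Rightarrow> (nat \<Rightarrow> real) set" where
  "unit_cube d = rect d (\<lambda>_. 0) (\<lambda>_. 1)"

(* The endpoints a k, b k of the k-th factor of a nonempty open rectangle, recovered from the
   set of its points; see lower_rect and upper_rect. *)

definition lower :: "(nat \<Rightarrow> real) set \<Rightarrow> nat \<Rightarrow> real" where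
  "lower R k = Inf ((\<lambda>x. x k) ` R)"

definition upper :: "(nat \<Rightarrow> real) set \<Rightarrow> nat \<Rightarrow> real" where
  "upper R k = Sup ((\<lambda>x. x k) ` R)"

definition cut :: "nat \<Rightarrow> (nat \<Rightarrow> real) set \<Rightarrow> nat \<Rightarrow> nat \<Rightarrow> real" where
  "cut p R i j = lower R i + real j / real p * (upper R i - lower R i)"

definition splitting :: "nat \<Rightarrow> nat \<Rightarrow> nat \<Rightarrow> (nat \<Rightarrow> real) set \<Rightarrow> (nat \<Rightarrow> real) set set" where
  "splitting d p i R =
     (\<lambda>j. rect d ((lower R)(i := cut p R i (j - 1))) ((upper R)(i := cut p R i j))) ` {1..p}"

inductive splits :: "nat \<Rightarrow> nat \<Rightarrow> nat \<Rightarrow> (nat \<Rightarrow> real) set set \<Rightarrow> bool" for d p :: nat where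
  start: "splits d p 0 {unit_cube d}"
| split: "splits d p k S \<Longrightarrow> R \<in> S \<Longrightarrow> i \<in> {1..d} \<Longrightarrow>
          splits d p (Suc k) ((S - {R}) \<union> splitting d p i R)"

definition decompositions :: "nat \<Rightarrow> nat \<Rightarrow> nat \<Rightarrow> (nat \<Rightarrow> real) set set set" where
  "decompositions d p n = {S. \<exists>m. n = 1 + m * (p - 1) \<and> splits d p m S}"

definition C :: "nat \<Rightarrow> nat \<Rightarrow> nat \<Rightarrow> nat" where
  "C d p n = card (decompositions d p n)"

datatype ptree = Leaf | Node nat "ptree list"

primrec leaves :: "ptree \<Rightarrow> nat" where
  "leaves Leaf = 1"
| "leaves (Node i ts) = sum_list (map leaves ts)"

fun full_tree :: "nat \<Rightarrow> nat \<Rightarrow> ptree \<Rightarrow> bool" where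
  "full_tree d p Leaf \<longleftrightarrow> True"
| "full_tree d p (Node i ts) \<longleftrightarrow>
     i \<in> {1..d} \<and> length ts = p \<and> (\<forall>t\<in>set ts. full_tree d p t)"

definition trees :: "nat \<Rightarrow> nat \<Rightarrow> nat \<Rightarrow> ptree set" where
  "trees d p n = {T. full_tree d p T \<and> leaves T = n}"

fun subtrees :: "ptree \<Rightarrow> ptree set" where
  "subtrees Leaf = {Leaf}"
| "subtrees (Node i ts) = insert (Node i ts) (\<Union>t\<in>set ts. subtrees t)"

definition L :: "nat \<Rightarrow> (nat \<Rightarrow> real) set \<Rightarrow> (nat \<Rightarrow> real) set \<Rightarrow> (nat \<Rightarrow> real) \<Rightarrow> (nat \<Rightarrow> real)" where
  "L d R R' x = (\<lambda>k\<in>{1..d}. lower R' k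
     + (upper R' k - lower R' k) / (upper R k - lower R k) * (x k - lower R k))"

definition scale ::
    "nat \<Rightarrow> (nat \<Rightarrow> real) set \<Rightarrow> (nat \<Rightarrow> real) set \<Rightarrow> (nat \<Rightarrow> real) set \<Rightarrow> (nat \<Rightarrow> real) set" where
  "scale d R R' R'' = L d R R' ` R''"

definition B :: "nat \<Rightarrow> nat \<Rightarrow> nat \<Rightarrow> nat \<Rightarrow> (nat \<Rightarrow> real) set" where
  "B d p i j = {x \<in> unit_cube d. (real j - 1) / real p < x i \<and> x i < real j / real p}"

(* The children are listed from position 0, so the j-th subtree is at position j - 1. *)

primrec f :: "nat \<Rightarrow> nat \<Rightarrow> ptree \<Rightarrow> (nat \<Rightarrow> real) set set" where
  "f d p Leaf = {unit_cube d}"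
| "f d p (Node i ts) =
     (\<Union>j\<in>{1..p}. scale d (unit_cube d) (B d p i j) ` (map (f d p) ts ! (j - 1)))"

definition interchange_maximal :: "nat \<Rightarrow> nat \<Rightarrow> ptree \<Rightarrow> bool" where
  "interchange_maximal d p T \<longleftrightarrow>
     \<not> (\<exists>i ts. Node i ts \<in> subtrees T \<and>
          (\<exists>n' j us. Node j us \<in> trees d p n' \<and> j > i \<and> f d p (Node j us) = f d p (Node i ts)))"

lemma proj_rect:
  assumes "\<And>k. k \<in> {1..d} \<Longrightarrow> a k < b k" and "k \<in> {1..d}"
  shows "(\<lambda>x. x k) ` rect d a b = {a k<..<b k}"
proof -
  have "rect d a b \<noteq> {}"
    using assms(1) by (force simp: rect_def PiE_eq_empty_iff)
  then show ?thesis
    using assms(2) by (simp add: rect_def image_projection_PiE)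
qed

lemma lower_rect:
  assumes "\<And>k. k \<in> {1..d} \<Longrightarrow> a k < b k" and "k \<in> {1..d}"
  shows "lower (rect d a b) k = a k"
proof -
  have "(\<lambda>x. x k) ` rect d a b = {a k<..<b k}"
    by (rule proj_rect) (use assms in auto)
  then show ?thesis
    using assms by (simp add: lower_def)
qed

lemma upper_rect:
  assumes "\<And>k. k \<in> {1..d} \<Longrightarrow> a k < b k" and "k \<in> {1..d}"
  shows "upper (rect d a b) k = b k"
proof -
  have "(\<lambda>x. x k) ` rect d a b = {a k<..<b k}"
    by (rule proj_rect) (use assms in auto)
  then show ?thesis
    using assms by (simp add: upper_def)
qed

lemma splitting_rect:
  assumes "\<And>k. k \<in> {1..d} \<Longrightarrow> a k < b k" and i: "i \<in> {1..d}"
  shows "splitting d p i (rect d a b) =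
    {rect d (a(i := a i + (real j - 1) / real p * (b i - a i)))
            (b(i := a i + real j / real p * (b i - a i))) | j. j \<in> {1..p}}"
proof -
  have lo: "lower (rect d a b) k = a k" and up: "upper (rect d a b) k = b k" if "k \<in> {1..d}" for k
    using lower_rect[of d a b k] upper_rect[of d a b k] assms(1) that by blast+
  have "rect d ((lower (rect d a b))(i := cut p (rect d a b) i (j - 1)))
               ((upper (rect d a b))(i := cut p (rect d a b) i j)) =
        rect d (a(i := a i + (real j - 1) / real p * (b i - a i)))
               (b(i := a i + real j / real p * (b i - a i)))" if "j \<in> {1..p}" for j
    unfolding rect_def[of d "(lower _)(_ := _)"] rect_def[of d "a(_ := _)"]
    by (rule PiE_cong) (use that in \<open>simp add: cut_def lo up lo[OF i] up[OF i] of_nat_diff\<close>)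
  then show ?thesis
    unfolding splitting_def by (auto simp: image_iff)
qed

lemma finite_splits: "finite {S. splits d p m S}"
proof (induction m)
  case 0
  have "{S. splits d p 0 S} \<subseteq> {{unit_cube d}}"
    by (auto elim: splits.cases)
  then show ?case by (rule finite_subset) simp
next
  case (Suc m)
  have fin: "finite S" if "splits d p k S" for k S
    using that by induction (auto simp: splitting_def)
  have "{S. splits d p (Suc m) S} \<subseteq>
     (\<Union>S\<in>{S. splits d p m S}. (\<lambda>(R, i). (S - {R}) \<union> splitting d p i R) ` (S \<times> {1..d}))"
    by (rule subsetI, drule CollectD, erule splits.cases) fastforce+
  then show ?case
    by (rule finite_subset) (use Suc fin in auto)
qed

lemma finite_decompositions:
  assumes "p \<ge> 2"
  shows "finite (decompositions d p n)"
proof -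
  have "m \<le> n" if "n = 1 + m * (p - 1)" for m
    using that assms by (cases "p - 1") auto
  then have "decompositions d p n \<subseteq> (\<Union>m\<le>n. {S. splits d p m S})"
    unfolding decompositions_def by blast
  then show ?thesis
    by (rule finite_subset) (simp add: finite_splits)
qed

lemma finite_trees:
  assumes "p \<ge> 2"
  shows "finite (trees d p n)"
proof (induction n rule: less_induct)
  case (less n)
  have pos: "leaves t \<ge> 1" if "full_tree d p t" for t
    using that
  proof (induction t)
    case (Node i ts)
    then obtain t ts' where ts: "ts = t # ts'"
      using assms by (cases ts) auto
    with Node show ?case by force
  qed simp
  let ?U = "\<Union>m<n. trees d p m"
  have "T \<in> insert Leaf ((\<lambda>(i, ts). Node i ts) ` ({1..d} \<times> {ts. set ts \<subseteq> ?U \<and> length ts = p}))"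
    if T: "T \<in> trees d p n" for T
  proof (cases T)
    case (Node i ts)
    have ft: "i \<in> {1..d}" "length ts = p" "\<And>t. t \<in> set ts \<Longrightarrow> full_tree d p t"
      and n: "sum_list (map leaves ts) = n"
      using T by (auto simp: trees_def Node)
    have "leaves t < n" if "t \<in> set ts" for t
    proof -
      obtain xs ys where ts: "ts = xs @ t # ys"
        using \<open>t \<in> set ts\<close> by (meson split_list)
      have "xs @ ys \<noteq> []" using ts ft(2) assms by auto
      then obtain u where u: "u \<in> set (xs @ ys)" by (cases "xs @ ys") auto
      have "1 \<le> leaves u" using u ts ft(3) pos by auto
      also have "leaves u \<le> sum_list (map leaves (xs @ ys))"
        using u by (intro member_le_sum_list) auto
      finally show ?thesis using n ts by simp
    qed
    then have "set ts \<subseteq> ?U" using ft(3) by (auto simp: trees_def)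
    then show ?thesis using ft Node by auto
  qed simp
  then have sub: "trees d p n \<subseteq>
      insert Leaf ((\<lambda>(i, ts). Node i ts) ` ({1..d} \<times> {ts. set ts \<subseteq> ?U \<and> length ts = p}))"
    by blast
  have "finite ?U" using less by auto
  then show ?case
    by (intro finite_subset[OF sub] finite.insertI finite_imageI finite_cartesian_product
        finite_lists_length_eq) auto
qed

end

(* Trees modulo equality of their images under f are the decompositions: f maps trees onto
   decompositions, because refining one rectangle amounts to replacing one leaf by an internal
   node whose children are leaves.  Two trees with the same image and the same root label have
   children with the same images, since each rectangle in f T lies in exactly one slab B i j.
   Interchange maximality forces the largest possible root label at every node, hence it selects
   exactly one tree in each fibre of f. *)

theory Submission
  imports Defs
begin

section \<open>Boxes in the unit cube and the scaling maps onto slabs\<close>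

text \<open>The strict inequality keeps the rectangle nonempty, so that its endpoints are determined
  by its points; the bounds 0 and 1 make the slab recoverable after scaling.\<close>

definition box :: "nat \<Rightarrow> (nat \<Rightarrow> real) \<Rightarrow> (nat \<Rightarrow> real) \<Rightarrow> bool" where
  "box d a b \<longleftrightarrow> (\<forall>k\<in>{1..d}. 0 \<le> a k \<and> a k < b k \<and> b k \<le> 1)"

definition boxes :: "nat \<Rightarrow> (nat \<Rightarrow> real) set set" where
  "boxes d = {rect d a b | a b. box d a b}"

(* Slabs are indexed from 0 here, as the children of a node. *)
definition shrink :: "nat \<Rightarrow> nat \<Rightarrow> nat \<Rightarrow> nat \<Rightarrow> (nat \<Rightarrow> real) set \<Rightarrow> (nat \<Rightarrow> real) set" where
  "shrink d p i k = scale d (unit_cube d) (B d p i (Suc k))"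

lemma rect_cong:
  assumes "\<And>k. k \<in> {1..d} \<Longrightarrow> a k = a' k" and "\<And>k. k \<in> {1..d} \<Longrightarrow> b k = b' k"
  shows "rect d a b = rect d a' b'"
  unfolding rect_def by (rule PiE_cong) (simp add: assms)

lemma rect_eqD:
  assumes "rect d a b = rect d a' b'" and "k \<in> {1..d}"
    and "\<And>k. k \<in> {1..d} \<Longrightarrow> a k < b k" and "\<And>k. k \<in> {1..d} \<Longrightarrow> a' k < b' k"
  shows "a k = a' k \<and> b k = b' k"
  using lower_rect[of d a b k] lower_rect[of d a' b' k]
    upper_rect[of d a b k] upper_rect[of d a' b' k] assms by simp

lemma unit_cube_in_boxes: "unit_cube d \<in> boxes d"
  unfolding boxes_def unit_cube_def box_def by force

text \<open>Puts a slab into the form to which \<open>lower_rect\<close> and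
  \<open>upper_rect\<close> apply.\<close>

lemma slab_eq_rect:
  assumes "i \<in> {1..d}" and "k < p"
  shows "B d p i (Suc k) = rect d ((\<lambda>_. 0)(i := real k / p)) ((\<lambda>_. 1)(i := (real k + 1) / p))"
proof -
  have bounds: "0 \<le> real k / p" "(real k + 1) / p \<le> 1"
    using assms(2) by (simp_all add: field_simps)
  show ?thesis
  proof (intro set_eqI iffI)
    fix x assume "x \<in> B d p i (Suc k)"
    then show "x \<in> rect d ((\<lambda>_. 0)(i := real k / p)) ((\<lambda>_. 1)(i := (real k + 1) / p))"
      by (simp add: B_def unit_cube_def rect_def PiE_iff add.commute)
  next
    fix x assume "x \<in> rect d ((\<lambda>_. 0)(i := real k / p)) ((\<lambda>_. 1)(i := (real k + 1) / p))"
    then have ext: "x \<in> extensional {1..d}"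
      and l: "\<And>l. l \<in> {1..d} \<Longrightarrow> ((\<lambda>_. 0)(i := real k / p)) l < x l \<and>
        x l < ((\<lambda>_. 1)(i := (real k + 1) / p)) l"
      unfolding rect_def PiE_iff greaterThanLessThan_iff by blast+
    have "0 < x l \<and> x l < 1" if "l \<in> {1..d}" for l
      using l[OF that] order.strict_trans1[OF bounds(1), of "x i"]
        order.strict_trans2[OF _ bounds(2), of "x i"] by (auto split: if_splits)
    then show "x \<in> B d p i (Suc k)"
      using ext l[OF assms(1)] assms(1)
      by (auto simp: B_def unit_cube_def rect_def PiE_iff add.commute)
  qed
qed

text \<open>A slab has full length in every coordinate except \<open>i\<close>, where it starts at
  k/p and has length 1/p; hence only that coordinate is changed.\<close>

lemma L_slab:
  assumes i: "i \<in> {1..d}" and k: "k < p"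
  shows "L d (unit_cube d) (B d p i (Suc k)) x =
    (\<lambda>l\<in>{1..d}. if l = i then (real k + x l) / p else x l)"
proof -
  have p: "real p > 0" using k by simp
  have cube: "lower (unit_cube d) l = 0" "upper (unit_cube d) l = 1" if "l \<in> {1..d}" for l
    using that by (simp_all add: unit_cube_def lower_rect upper_rect)
  have slab: "lower (B d p i (Suc k)) l = (if l = i then real k / p else 0)"
    "upper (B d p i (Suc k)) l = (if l = i then (real k + 1) / p else 1)" if "l \<in> {1..d}" for l
    using that p unfolding slab_eq_rect[OF i k]
    by (subst lower_rect upper_rect; auto simp: divide_strict_right_mono)+
  show ?thesis
    unfolding L_def by (rule restrict_ext) (use p in \<open>simp add: cube slab field_simps\<close>)
qed

lemma shrink_rect:
  assumes i: "i \<in> {1..d}" and k: "k < p"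
  shows "shrink d p i k (rect d a b) =
    rect d (a(i := (real k + a i) / p)) (b(i := (real k + b i) / p))" (is "?l = ?r")
proof
  have p: "real p > 0" using k by simp
  show "?l \<subseteq> ?r"
    using p by (auto simp: shrink_def scale_def L_slab[OF i k] rect_def PiE_iff
        divide_strict_right_mono)
  show "?r \<subseteq> ?l"
  proof
    fix y assume y: "y \<in> ?r"
    \<comment> \<open>The inverse of the formula in \<open>L_slab\<close>. Outside the index set
      both functions have the value \<open>undefined\<close>, which the next fact supplies for
      \<open>y\<close>.\<close>
    define x where "x = (\<lambda>l\<in>{1..d}. if l = i then p * y l - real k else y l)"
    have yl: "y l = undefined" if "l \<notin> {1..d}" for l
      using y that by (simp add: rect_def PiE_iff extensional_def)
    have "y = L d (unit_cube d) (B d p i (Suc k)) x"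
      using p yl by (auto simp: L_slab[OF i k] x_def fun_eq_iff)
    moreover have "x \<in> rect d a b"
      unfolding rect_def
    proof (rule PiE_I)
      fix l assume l: "l \<in> {1..d}"
      then have "y l \<in> {(a(i := (real k + a i) / p)) l <..< (b(i := (real k + b i) / p)) l}"
        using y unfolding rect_def by blast
      then show "x l \<in> {a l<..<b l}"
        using p l by (auto simp: x_def field_simps split: if_splits)
    qed (auto simp: x_def)
    ultimately show "y \<in> ?l"
      unfolding shrink_def scale_def by blast
  qed
qed

lemma box_shrink:
  assumes "k < p" and "box d a b"
  shows "box d (a(i := (real k + a i) / p)) (b(i := (real k + b i) / p))"
proof -
  have p: "real p > 0" "real k + 1 \<le> p" using assms(1) by auto
  have "0 \<le> (real k + s) / p \<and> (real k + s) / p < (real k + t) / p \<and> (real k + t) / p \<le> 1"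
    if "0 \<le> s" "s < t" "t \<le> 1" for s t
    using p that by (simp add: divide_strict_right_mono divide_le_eq)
  then show ?thesis
    using assms(2) unfolding box_def by fastforce
qed

lemma shrink_in_boxes:
  assumes "i \<in> {1..d}" "k < p" "R \<in> boxes d"
  shows "shrink d p i k R \<in> boxes d"
proof -
  obtain a b where "R = rect d a b" "box d a b"
    using assms(3) by (auto simp: boxes_def)
  then show ?thesis
    using shrink_rect[OF assms(1,2)] box_shrink[OF assms(2)] unfolding boxes_def by blast
qed

text \<open>After multiplication by p, the left endpoint in coordinate \<open>i\<close> is k + a i
  with 0 \<le> a i < 1: the integer part gives the slab, the fractional part the original endpoint.
  So distinct slabs share no scaled box, and scaling into one slab loses nothing.\<close>

lemma shrink_inject:
  assumes i: "i \<in> {1..d}" and k: "k < p" and l: "l < p"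
    and R: "R \<in> boxes d" and R': "R' \<in> boxes d"
    and eq: "shrink d p i k R = shrink d p i l R'"
  shows "k = l \<and> R = R'"
proof -
  obtain a b where ab: "R = rect d a b" "box d a b"
    using R by (auto simp: boxes_def)
  obtain a' b' where ab': "R' = rect d a' b'" "box d a' b'"
    using R' by (auto simp: boxes_def)
  let ?s = "\<lambda>k (a :: nat \<Rightarrow> real). a(i := (real k + a i) / p)"
  have p: "real p > 0" using k by simp
  have "rect d (?s k a) (?s k b) = rect d (?s l a') (?s l b')"
    using eq by (simp only: ab(1) ab'(1) shrink_rect[OF i k] shrink_rect[OF i l])
  then have coord: "?s k a m = ?s l a' m \<and> ?s k b m = ?s l b' m" if "m \<in> {1..d}" for m
    by (rule rect_eqD[OF _ that])
      (use box_shrink[OF k ab(2)] box_shrink[OF l ab'(2)] in \<open>auto simp: box_def\<close>)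
  have ends: "real k + a i = real l + a' i" "real k + b i = real l + b' i"
    using coord[OF i] p by auto
  have "0 \<le> a i" "a i < 1" "0 \<le> a' i" "a' i < 1"
    using ab(2) ab'(2) i unfolding box_def by force+
  then have kl: "k = l"
    using ends(1) by linarith
  have "a m = a' m \<and> b m = b' m" if "m \<in> {1..d}" for m
    using coord[OF that] ends kl by (auto split: if_splits)
  then show ?thesis
    using kl ab(1) ab'(1) rect_cong by blast
qed

section \<open>Splitting and its compatibility with scaling\<close>

lemma splitting_box:
  assumes "box d a b" "i \<in> {1..d}"
  shows "splitting d p i (rect d a b) =
    (\<lambda>j. rect d (a(i := a i + real j / p * (b i - a i)))
                (b(i := a i + (real j + 1) / p * (b i - a i)))) ` {..<p}"
proof -
  have "{1..p} = Suc ` {..<p}"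
    by (simp add: lessThan_atLeast0 image_Suc_atLeastLessThan atLeastLessThanSuc_atLeastAtMost)
  moreover have "splitting d p i (rect d a b) =
    (\<lambda>j. rect d (a(i := a i + (real j - 1) / p * (b i - a i)))
            (b(i := a i + real j / p * (b i - a i)))) ` {1..p}"
    using splitting_rect[of d a b i p] assms by (auto simp: box_def)
  ultimately show ?thesis
    by (simp add: image_image add.commute)
qed

lemma splitting_unit_cube:
  assumes "i \<in> {1..d}"
  shows "splitting d p i (unit_cube d) = (\<lambda>k. shrink d p i k (unit_cube d)) ` {..<p}"
proof -
  have "box d (\<lambda>_. 0) (\<lambda>_. 1)" by (simp add: box_def)
  from splitting_box[OF this assms, of p] show ?thesis
    by (auto simp: unit_cube_def shrink_rect[OF assms] image_iff)
qed

text \<open>An affine map in each coordinate takes equally spaced cut points to equally spaced cut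
  points, whether or not \<open>i\<close> is the scaled coordinate \<open>j\<close>. This carries a
  split inside a child up to its parent.\<close>

lemma splitting_shrink:
  assumes i: "i \<in> {1..d}" and j: "j \<in> {1..d}" and k: "k < p" and R: "R \<in> boxes d"
  shows "splitting d p i (shrink d p j k R) = shrink d p j k ` splitting d p i R"
proof -
  obtain a b where ab: "R = rect d a b" "box d a b"
    using R by (auto simp: boxes_def)
  have p: "real p > 0" using k by simp
  show ?thesis
    unfolding ab(1) shrink_rect[OF j k] splitting_box[OF ab(2) i]
      splitting_box[OF box_shrink[OF k ab(2)] i] image_image
    by (intro image_cong refl rect_cong) (use p in \<open>auto simp: field_simps\<close>)
qed

section \<open>Images of trees: recovery of children and count of leaves\<close>

lemma f_Node:
  assumes "length ts = p"
  shows "f d p (Node i ts) = (\<Union>k<p. shrink d p i k ` f d p (ts ! k))"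
proof -
  have "{1..p} = Suc ` {..<p}"
    by (simp add: lessThan_atLeast0 image_Suc_atLeastLessThan atLeastLessThanSuc_atLeastAtMost)
  then show ?thesis
    using assms by (auto simp: shrink_def)
qed

declare f.simps(2) [simp del]

lemma f_subset_boxes:
  assumes "full_tree d p T"
  shows "f d p T \<subseteq> boxes d"
  using assms
proof (induction T)
  case Leaf
  then show ?case by (simp add: unit_cube_in_boxes)
next
  case (Node i ts)
  have i: "i \<in> {1..d}" and len: "length ts = p" and sub: "f d p (ts ! k) \<subseteq> boxes d" if "k < p" for k
    using Node that by auto
  show ?case
  proof
    fix R assume "R \<in> f d p (Node i ts)"
    then obtain k R' where "k < p" "R' \<in> f d p (ts ! k)" "R = shrink d p i k R'"
      using Node.prems by (auto simp: f_Node)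
    then show "R \<in> boxes d"
      using shrink_in_boxes i sub by blast
  qed
qed

text \<open>A rectangle of child \<open>k\<close>, once scaled, must arise from some child of the
  other tree, and \<open>shrink_inject\<close> forces the same child and the same rectangle. The
  situation is symmetric, so one inclusion is proved for arbitrary children and used twice.\<close>

lemma f_Node_eqD:
  assumes T: "full_tree d p (Node i ts)" and U: "full_tree d p (Node i us)"
    and eq: "f d p (Node i ts) = f d p (Node i us)" and k: "k < p"
  shows "f d p (ts ! k) = f d p (us ! k)"
proof -
  have "f d p (ts ! k) \<subseteq> f d p (us ! k)"
    if T: "full_tree d p (Node i ts)" and U: "full_tree d p (Node i us)"
      and eq: "f d p (Node i ts) = f d p (Node i us)" for ts us
  proof
    fix R assume R: "R \<in> f d p (ts ! k)"
    have "shrink d p i k R \<in> f d p (Node i us)"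
      using R T k unfolding eq[symmetric] by (auto simp: f_Node)
    then obtain l R' where l: "l < p" "R' \<in> f d p (us ! l)" "shrink d p i k R = shrink d p i l R'"
      using U by (auto simp: f_Node)
    have "R \<in> boxes d" "R' \<in> boxes d"
      using f_subset_boxes[of d p "ts ! k"] f_subset_boxes[of d p "us ! l"] T U k l R by auto
    then show "R \<in> f d p (us ! k)"
      using shrink_inject[of i d k p l R R'] T k l by auto
  qed
  from this[OF T U eq] this[OF U T eq[symmetric]] show ?thesis by blast
qed

lemma leaves_Node:
  assumes "length ts = p"
  shows "leaves (Node i ts) = (\<Sum>k<p. leaves (ts ! k))"
  using assms by (simp add: sum_list_sum_nth lessThan_atLeast0)

lemma leaves_pos:
  assumes "full_tree d p T" "p \<ge> 2"
  shows "leaves T > 0"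
  using assms
proof (induction T)
  case (Node i ts)
  then have "leaves (ts ! 0) > 0" by auto
  moreover have "leaves (ts ! 0) \<le> leaves (Node i ts)"
    using Node.prems by (auto intro!: member_le_sum_list imageI nth_mem)
  ultimately show ?case by linarith
qed simp

text \<open>As p \<ge> 2, there is a sibling, and it contributes at least one leaf.\<close>

lemma leaves_child_less:
  assumes T: "full_tree d p (Node i ts)" and p: "p \<ge> 2" and k: "k < p"
  shows "leaves (ts ! k) < leaves (Node i ts)"
proof -
  obtain l where l: "l < p" "l \<noteq> k"
    using p by (metis One_nat_def Suc_1 Suc_le_lessD less_trans zero_less_one zero_neq_one)
  have "(\<Sum>k\<in>{k}. leaves (ts ! k)) < (\<Sum>k<p. leaves (ts ! k))"
    using T k l leaves_pos[OF _ p, of d "ts ! l"] by (intro sum_strict_mono2[of _ _ l]) auto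
  then show ?thesis
    using T leaves_Node[of ts p i] by simp
qed

text \<open>By \<open>shrink_inject\<close> no two leaves yield the same rectangle. Consequently
  trees with equal images have equally many leaves, so a fibre of \<open>f\<close> stays within one
  \<open>trees d p n\<close>.\<close>

lemma card_f:
  assumes "full_tree d p T"
  shows "finite (f d p T) \<and> card (f d p T) = leaves T"
  using assms
proof (induction T)
  case (Node i ts)
  then have i: "i \<in> {1..d}" and len: "length ts = p"
    and ch: "\<And>k. k < p \<Longrightarrow> full_tree d p (ts ! k)"
    and IH: "\<And>k. k < p \<Longrightarrow> finite (f d p (ts ! k)) \<and> card (f d p (ts ! k)) = leaves (ts ! k)"
    by auto
  have "card (shrink d p i k ` f d p (ts ! k)) = leaves (ts ! k)" if "k < p" for k
  proof -
    have "inj_on (shrink d p i k) (f d p (ts ! k))"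
      using shrink_inject[OF i that that] f_subset_boxes[OF ch[OF that]] by (auto simp: inj_on_def)
    then show ?thesis
      using IH[OF that] by (simp add: card_image)
  qed
  moreover have "card (\<Union>k<p. shrink d p i k ` f d p (ts ! k)) =
      (\<Sum>k<p. card (shrink d p i k ` f d p (ts ! k)))"
  proof (rule card_UN_disjoint)
    show "\<forall>k\<in>{..<p}. \<forall>l\<in>{..<p}. k \<noteq> l \<longrightarrow>
        shrink d p i k ` f d p (ts ! k) \<inter> shrink d p i l ` f d p (ts ! l) = {}"
    proof (intro ballI impI)
      fix k l assume kl: "k \<in> {..<p}" "l \<in> {..<p}" "k \<noteq> l"
      have "shrink d p i k R \<noteq> shrink d p i l R'"
        if "R \<in> f d p (ts ! k)" "R' \<in> f d p (ts ! l)" for R R'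
        using shrink_inject[OF i, of k p l R R'] kl that
          f_subset_boxes[OF ch[of k]] f_subset_boxes[OF ch[of l]] by auto
      then show "shrink d p i k ` f d p (ts ! k) \<inter> shrink d p i l ` f d p (ts ! l) = {}"
        by blast
    qed
  qed (use IH in auto)
  ultimately show ?case
    using len IH by (simp add: f_Node leaves_Node del: leaves.simps(2))
qed simp

section \<open>One splitting step as a relation between trees\<close>

text \<open>Only the images and the leaf counts are related, not the shapes of the trees. The count
  is stated additively to avoid subtraction of naturals.\<close>

definition refines :: "nat \<Rightarrow> nat \<Rightarrow> ptree \<Rightarrow> (nat \<Rightarrow> real) set \<Rightarrow> nat \<Rightarrow> ptree \<Rightarrow> bool" where
  "refines d p T R i T' \<longleftrightarrow> full_tree d p T \<and> full_tree d p T' \<and> R \<in> f d p T \<and> i \<in> {1..d} \<and>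
     f d p T' = f d p T - {R} \<union> splitting d p i R \<and> leaves T' + 1 = leaves T + p"

lemma refines_Leaf:
  assumes "i \<in> {1..d}"
  shows "refines d p Leaf (unit_cube d) i (Node i (replicate p Leaf))"
  using assms by (auto simp: refines_def f_Node splitting_unit_cube sum_list_replicate)

lemma refines_Node:
  assumes ref: "refines d p (ts ! k) R i T'" and T: "full_tree d p (Node j ts)" and k: "k < p"
  shows "refines d p (Node j ts) (shrink d p j k R) i (Node j (ts[k := T']))"
proof -
  have j: "j \<in> {1..d}" and len: "length ts = p"
    and ch: "\<And>l. l < p \<Longrightarrow> full_tree d p (ts ! l)"
    using T by auto
  have T': "full_tree d p T'" and R: "R \<in> f d p (ts ! k)" and i: "i \<in> {1..d}"
    and f': "f d p T' = f d p (ts ! k) - {R} \<union> splitting d p i R"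
    and lv: "leaves T' + 1 = leaves (ts ! k) + p"
    using ref by (auto simp: refines_def)
  let ?g = "shrink d p j" and ?F = "\<lambda>l. f d p (ts ! l)"
  have Rb: "R \<in> boxes d" using R f_subset_boxes[OF ch[OF k]] by blast
  \<comment> \<open>The removed rectangle has a single preimage among all children, so removing it
    from the union is the same as removing \<open>R\<close> from child \<open>k\<close> before
    scaling.\<close>
  have only: "l = k \<and> Q = R" if "l < p" "Q \<in> ?F l" "?g l Q = ?g k R" for l Q
    using shrink_inject[OF j that(1) k _ Rb that(3)] f_subset_boxes[OF ch[OF that(1)]] that(2)
    by blast
  have full': "full_tree d p (Node j (ts[k := T']))"
    using T T' set_update_subset_insert[of ts k T'] by auto
  have union: "(\<Union>l<p. X l) = X k \<union> (\<Union>l\<in>{..<p} - {k}. X l)" for X :: "nat \<Rightarrow> (nat \<Rightarrow> real) set set"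
    using k by blast
  have "f d p (Node j (ts[k := T'])) =
      ?g k ` (?F k - {R} \<union> splitting d p i R) \<union> (\<Union>l\<in>{..<p} - {k}. ?g l ` ?F l)"
    using len k by (subst f_Node, simp, subst union) (simp add: f')
  also have "?g k ` (?F k - {R} \<union> splitting d p i R) =
      (?g k ` ?F k - {?g k R}) \<union> splitting d p i (?g k R)"
    using only[OF k] R unfolding splitting_shrink[OF i j k Rb] by blast
  also have "\<dots> \<union> (\<Union>l\<in>{..<p} - {k}. ?g l ` ?F l) =
      (?g k ` ?F k \<union> (\<Union>l\<in>{..<p} - {k}. ?g l ` ?F l)) - {?g k R} \<union> splitting d p i (?g k R)"
    using only by blast
  also have "?g k ` ?F k \<union> (\<Union>l\<in>{..<p} - {k}. ?g l ` ?F l) = f d p (Node j ts)"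
    unfolding f_Node[OF len] using union[of "\<lambda>l. ?g l ` ?F l"] by simp
  finally have "f d p (Node j (ts[k := T'])) =
      f d p (Node j ts) - {?g k R} \<union> splitting d p i (?g k R)" .
  moreover have "?g k R \<in> f d p (Node j ts)"
    using R k by (auto simp: f_Node[OF len])
  moreover have "leaves (Node j (ts[k := T'])) + 1 = leaves (Node j ts) + p"
  proof -
    \<comment> \<open>Updating a list subtracts the old entry from the sum; this bound keeps the
      subtraction of naturals exact.\<close>
    have "leaves (ts ! k) \<le> sum_list (map leaves ts)"
      using k len by (auto intro!: member_le_sum_list imageI nth_mem)
    then show ?thesis
      using k len lv by (simp add: map_update sum_list_update)
  qed
  ultimately show ?thesis
    using T full' i by (simp only: refines_def simp_thms)
qed

text \<open>Descend to the leaf that carries \<open>R\<close>, give it p leaf children, and carry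
  the refinement back up by \<open>refines_Node\<close>.\<close>

lemma refines_exists:
  assumes "full_tree d p T" "R \<in> f d p T" "i \<in> {1..d}"
  shows "\<exists>T'. refines d p T R i T'"
  using assms
proof (induction T arbitrary: R)
  case Leaf
  then show ?case using refines_Leaf by auto
next
  case (Node j ts)
  then obtain k R' where k: "k < p" "R' \<in> f d p (ts ! k)" "R = shrink d p j k R'"
    by (auto simp: f_Node)
  then obtain T' where "refines d p (ts ! k) R' i T'"
    using Node.IH[of "ts ! k" R'] Node.prems by auto
  then show ?case
    using refines_Node Node.prems k by blast
qed

text \<open>Descending through internal children ends at a node all of whose children are leaves;
  turning that node into a leaf undoes one split.\<close>

lemma coarsening_exists:
  assumes "full_tree d p T" "T \<noteq> Leaf"
  shows "\<exists>T0 R i. refines d p T0 R i T"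
  using assms
proof (induction T)
  case (Node j ts)
  then have len: "length ts = p" and j: "j \<in> {1..d}" by auto
  show ?case
  proof (cases "\<forall>t\<in>set ts. t = Leaf")
    case True
    then have "ts = replicate p Leaf"
      using len replicate_length_same by metis
    then show ?thesis
      using refines_Leaf[OF j] by blast
  next
    case False
    then obtain k where k: "k < p" "ts ! k \<noteq> Leaf"
      using len by (auto simp: in_set_conv_nth)
    then obtain T0 R i where T0: "refines d p T0 R i (ts ! k)"
      using Node.IH[of "ts ! k"] Node.prems len by auto
    have "full_tree d p (Node j (ts[k := T0]))"
      using T0 Node.prems set_update_subset_insert[of ts k T0] by (auto simp: refines_def)
    \<comment> \<open>The second update restores the original child, so the refined tree is the
      given one.\<close>
    then have "refines d p (Node j (ts[k := T0])) (shrink d p j k R) i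
        (Node j ((ts[k := T0])[k := ts ! k]))"
      using T0 k len by (intro refines_Node) auto
    then show ?thesis by auto
  qed
qed simp

section \<open>Decompositions as the images of trees\<close>

text \<open>Peels off one refinement at a time. The induction is on the number of leaves, since the
  coarser tree need not be a subtree; p \<ge> 2 makes the count drop.\<close>

lemma splits_f:
  assumes "full_tree d p T" "p \<ge> 2"
  shows "\<exists>m. leaves T = 1 + m * (p - 1) \<and> splits d p m (f d p T)"
  using assms(1)
proof (induction "leaves T" arbitrary: T rule: less_induct)
  case less
  show ?case
  proof (cases "T = Leaf")
    case True
    then show ?thesis using splits.start by (intro exI[of _ 0]) simp
  next
    case False
    then obtain T0 R i where ref: "refines d p T0 R i T"
      using coarsening_exists less.prems by blast
    then have "leaves T0 < leaves T"
      using assms(2) by (simp add: refines_def)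
    then obtain m where m: "leaves T0 = 1 + m * (p - 1)" "splits d p m (f d p T0)"
      using less.hyps[of T0] ref by (auto simp: refines_def)
    have "splits d p (Suc m) (f d p T)"
      using splits.split[OF m(2)] ref by (simp add: refines_def)
    moreover have "leaves T = 1 + Suc m * (p - 1)"
      using m(1) ref assms(2) by (simp add: refines_def)
    ultimately show ?thesis by blast
  qed
qed

lemma splits_imp_tree:
  assumes "splits d p m S" "p \<ge> 2"
  shows "\<exists>T. full_tree d p T \<and> leaves T = 1 + m * (p - 1) \<and> f d p T = S"
  using assms(1)
proof induction
  case start
  show ?case by (intro exI[of _ Leaf]) simp
next
  case (split k S R i)
  then obtain T where T: "full_tree d p T" "leaves T = 1 + k * (p - 1)" "f d p T = S"
    by blast
  then obtain T' where "refines d p T R i T'"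
    using refines_exists split.hyps by blast
  then show ?case
    using T assms(2) by (intro exI[of _ T']) (auto simp: refines_def)
qed

lemma decompositions_eq_image:
  assumes "p \<ge> 2"
  shows "decompositions d p n = f d p ` trees d p n"
proof
  show "decompositions d p n \<subseteq> f d p ` trees d p n"
    using splits_imp_tree[OF _ assms] by (force simp: decompositions_def trees_def)
  show "f d p ` trees d p n \<subseteq> decompositions d p n"
    using splits_f[OF _ assms] by (force simp: decompositions_def trees_def)
qed

section \<open>Interchange maximal trees as representatives of the fibres\<close>

text \<open>The size of a competing tree is arbitrary, so of its membership in \<open>trees\<close>
  only fullness remains.\<close>

lemma interchange_maximal_iff:
  "interchange_maximal d p T \<longleftrightarrow>
     (\<forall>i ts. Node i ts \<in> subtrees T \<longrightarrow>
       (\<forall>j us. full_tree d p (Node j us) \<longrightarrow> f d p (Node j us) = f d p (Node i ts) \<longrightarrow> j \<le> i))"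
  unfolding interchange_maximal_def trees_def mem_Collect_eq not_less[symmetric] by blast

lemma interchange_maximal_Leaf: "interchange_maximal d p Leaf"
  by (simp add: interchange_maximal_def)

lemma interchange_maximal_Node:
  "interchange_maximal d p (Node i ts) \<longleftrightarrow> (\<forall>t\<in>set ts. interchange_maximal d p t) \<and>
     (\<forall>j us. full_tree d p (Node j us) \<longrightarrow> f d p (Node j us) = f d p (Node i ts) \<longrightarrow> j \<le> i)"
  unfolding interchange_maximal_iff subtrees.simps by blast

lemma leaves_Node_gt_1:
  assumes "full_tree d p (Node i ts)" "p \<ge> 2"
  shows "leaves (Node i ts) > 1"
proof -
  have "leaves (ts ! 0) > 0"
    using assms by (intro leaves_pos[of d p]) auto
  moreover have "leaves (ts ! 0) < leaves (Node i ts)"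
    using assms by (intro leaves_child_less[of d p]) auto
  ultimately show ?thesis by linarith
qed

text \<open>Each tree competes with the other at the root, so the labels agree; then
  \<open>f_Node_eqD\<close> gives children with equal images, and induction makes them
  equal.\<close>

lemma interchange_maximal_unique:
  assumes "full_tree d p T" "full_tree d p U" "p \<ge> 2"
    and "interchange_maximal d p T" "interchange_maximal d p U" "f d p T = f d p U"
  shows "T = U"
  using assms
proof (induction T arbitrary: U)
  case Leaf
  \<comment> \<open>A single rectangle in the image excludes an internal root, which would give more
    than one leaf.\<close>
  have "card (f d p U) = 1"
    unfolding Leaf.prems(6)[symmetric] by simp
  then have "leaves U = 1"
    using card_f[OF Leaf.prems(2)] by simp
  then show ?case
    using leaves_Node_gt_1[OF _ Leaf.prems(3)] Leaf.prems(2) by (cases U) (simp, metis less_irrefl)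
next
  case (Node i ts)
  have "leaves (Node i ts) = leaves U"
    using card_f[OF Node.prems(1)] card_f[OF Node.prems(2)] Node.prems(6) by metis
  then obtain j us where U: "U = Node j us"
    using leaves_Node_gt_1[OF Node.prems(1,3)]
    by (cases U) auto
  have "i \<le> j" "j \<le> i"
    using Node.prems(1,2,4,5,6) unfolding U interchange_maximal_Node by blast+
  then have ij: "j = i" by simp
  have len: "length ts = p" "length us = p"
    using Node.prems U by auto
  have "ts ! k = us ! k" if "k < p" for k
  proof (rule Node.IH)
    show "f d p (ts ! k) = f d p (us ! k)"
      using f_Node_eqD Node.prems that unfolding U ij by blast
  qed (use Node.prems that len in \<open>auto simp: U interchange_maximal_Node\<close>)
  then show ?case
    unfolding U ij using len by (simp add: list_eq_iff_nth_eq)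
qed

text \<open>Choose the largest root label in the fibre, then replace every child by a maximal tree
  with the same image. The chosen children need not be subtrees of \<open>T\<close>, whence the
  induction on leaves.\<close>

lemma interchange_maximal_exists:
  assumes "full_tree d p T" "p \<ge> 2"
  shows "\<exists>U. full_tree d p U \<and> interchange_maximal d p U \<and> f d p U = f d p T"
  using assms(1)
proof (induction "leaves T" arbitrary: T rule: less_induct)
  case less
  show ?case
  proof (cases T)
    case Leaf
    then show ?thesis
      using interchange_maximal_Leaf by (intro exI[of _ Leaf]) simp
  next
    case (Node i ts)
    define P where "P j \<longleftrightarrow> (\<exists>us. full_tree d p (Node j us) \<and> f d p (Node j us) = f d p T)" for j
    have "P i" using Node less.prems by (auto simp: P_def)
    moreover have bound: "j \<le> d" if "P j" for j
      using that by (auto simp: P_def)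
    \<comment> \<open>Labels are at most \<open>d\<close>, so a greatest attainable one
      exists.\<close>
    ultimately obtain j where j: "P j" "\<And>l. P l \<Longrightarrow> l \<le> j"
      using GreatestI_nat[of P i d] Greatest_le_nat[of P _ d] by blast
    then obtain us where us: "full_tree d p (Node j us)" "f d p (Node j us) = f d p T"
      by (auto simp: P_def)
    have lv: "leaves (Node j us) = leaves T"
      using card_f[OF us(1)] card_f[OF less.prems] us(2) by simp
    have "\<exists>U. full_tree d p U \<and> interchange_maximal d p U \<and> f d p U = f d p (us ! k)" if "k < p" for k
      using less.hyps[of "us ! k"] leaves_child_less[OF us(1) assms(2) that] us(1) lv that by auto
    then obtain V where V: "\<And>k. k < p \<Longrightarrow> full_tree d p (V k)"
      "\<And>k. k < p \<Longrightarrow> interchange_maximal d p (V k)" "\<And>k. k < p \<Longrightarrow> f d p (V k) = f d p (us ! k)"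
      by metis
    let ?U = "Node j (map V [0..<p])"
    have full: "full_tree d p ?U" using us(1) V(1) by auto
    have eq: "f d p ?U = f d p T"
      unfolding us(2)[symmetric] using us(1) V(3) by (simp add: f_Node)
    \<comment> \<open>The condition at the root depends only on its label and the image, so it
      survives the exchange of children.\<close>
    have "interchange_maximal d p ?U"
      unfolding interchange_maximal_Node eq using V(2) j(2) by (auto simp: P_def)
    then show ?thesis
      using full eq by blast
  qed
qed

theorem theorem19:
  fixes d p n :: nat
  assumes "d \<ge> 1" and "p \<ge> 2" and "n \<ge> 1"
  shows "C d p n = card {T \<in> trees d p n. interchange_maximal d p T}"
proof -
  let ?M = "{T \<in> trees d p n. interchange_maximal d p T}"
  have "inj_on (f d p) ?M"
    using interchange_maximal_unique[OF _ _ assms(2)] by (auto simp: inj_on_def trees_def)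
  moreover have "f d p ` ?M = decompositions d p n"
    unfolding decompositions_eq_image[OF assms(2)]
  proof
    show "f d p ` trees d p n \<subseteq> f d p ` ?M"
    proof
      fix S assume "S \<in> f d p ` trees d p n"
      then obtain T where T: "full_tree d p T" "leaves T = n" "S = f d p T"
        by (auto simp: trees_def)
      then obtain U where U: "full_tree d p U" "interchange_maximal d p U" "f d p U = f d p T"
        using interchange_maximal_exists[OF _ assms(2)] by blast
      \<comment> \<open>The number of leaves is the cardinality of the image, so the representative
        has the required size.\<close>
      have "leaves U = n"
        using card_f[OF U(1)] card_f[OF T(1)] U(3) T(2) by simp
      then show "S \<in> f d p ` ?M"
        using U T by (auto simp: trees_def)
    qed
  qed auto
  ultimately show ?thesis
    unfolding C_def by (metis card_image)
qed

end
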